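(* Let $N\ge1$ and consider the weighted spider network $G$ with $N$ legs and parameters $\gamma=(\gamma_1,\gamma_2^{(1)},\dots,\gamma_2^{(N)},\gamma_3)\in\mathbb R_+\times(\mathbb R_+^* )^{N+1}$. Put $\mathcal S_2=\gamma_2^{(1)}+\cdots+\gamma_2^{(N)}$ and assume $\Lambda=2\gamma_3-\gamma_1-\mathcal S_2=0$. Then there exists a unique MERW on $G$. The positive right eigenfunction (associated with the spectral radius, unique up to a multiplicative constant) is $\psi\equiv1$. For all $1\le k\le N$ and $n\ge1$ the transition probabilities are $$P((n,k),(n+1,k))=\tfrac12,\quad P((n,k),(n-1,k))=\tfrac12,\quad P(\mathbf 0,(1,k))=\frac{\gamma_2^{(k)}}{2\gamma_3},\quad P(\mathbf 0,\mathbf 0)=\frac{\gamma_1}{2\gamma_3}.$$ The process is null-recurrent, with an invariant measure given by $\pi((n,k))=\gamma_2^{(k)}$ for $n\ge1$, $1\le k\le N$, and $\pi(\mathbf 0)=\gamma_3$.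
   Context: The weighted spider network has vertex set $G=\{(n,k):n\in\mathbb N_0,\ 1\le k\le N\}$ with the identification $\mathbf 0=(0,1)=\cdots=(0,N)$. Its weighted adjacency matrix $A$ is given, for $n\ge1$ and $1\le k\le N$, by $A(\mathbf 0,\mathbf 0)=\gamma_1$, $A(\mathbf 0,(1,k))=\gamma_2^{(k)}$, $A((n,k),(n\pm1,k))=\gamma_3$, and $A=0$ otherwise. Here $\mathbb R_+=[0,\infty)$ and $\mathbb R_+^*=(0,\infty)$. The combinatorial spectral radius $\rho$ is the inverse of the radius of convergence of $\sum_{n\ge0}A^n(x,y)z^n$, which does not depend on $x,y\in G$. A MERW (maximal entropy random walk) on $G$ is a Markov chain with kernel $P(x,y)=A(x,y)\frac{\psi(y)}{\rho\,\psi(x)}$, where $\psi:G\to(0,\infty)$ satisfies $A\psi=\rho\psi$. Uniqueness of the MERW means uniqueness of the kernel $P$. *)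

theory Defs
  imports "HOL-Analysis.Analysis"
begin

text \<open>
  Matrices over a countable index set \<open>G :: 'a set\<close> are functions \<open>'a \<Rightarrow> 'a \<Rightarrow> real\<close>;
  only their values on \<open>G \<times> G\<close> are meaningful. The infinite sums below are absolutely
  convergent for matrices with finitely supported rows and for Markov kernels.
\<close>

type_synonym 'a matrix = "'a \<Rightarrow> 'a \<Rightarrow> real"

primrec mat_pow :: "'a set \<Rightarrow> 'a matrix \<Rightarrow> nat \<Rightarrow> 'a matrix" where
  "mat_pow G A 0 = (\<lambda>x y. if x = y then 1 else 0)"
| "mat_pow G A (Suc n) = (\<lambda>x y. \<Sum>\<^sub>\<infinity>z\<in>G. A x z * mat_pow G A n z y)"

text \<open>
  The description is meaningful when the radius of convergence is the same (and nonzero)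
  for all \<open>x, y \<in> G\<close>, as is the case for irreducible locally finite networks with
  bounded weights and degrees.
\<close>

definition comb_spectral_radius :: "'a set \<Rightarrow> 'a matrix \<Rightarrow> real" where
  "comb_spectral_radius G A =
     (THE r. \<forall>x\<in>G. \<forall>y\<in>G. ereal r = inverse (conv_radius (\<lambda>n. mat_pow G A n x y)))"

definition positive_eigenfunction :: "'a set \<Rightarrow> 'a matrix \<Rightarrow> real \<Rightarrow> ('a \<Rightarrow> real) \<Rightarrow> bool" where
  "positive_eigenfunction G A r \<psi> \<longleftrightarrow>
     (\<forall>x\<in>G. \<psi> x > 0) \<and> (\<forall>x\<in>G. ((\<lambda>y. A x y * \<psi> y) has_sum (r * \<psi> x)) G)"

definition markov_kernel :: "'a set \<Rightarrow> 'a matrix \<Rightarrow> bool" where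
  "markov_kernel G P \<longleftrightarrow>
     (\<forall>x\<in>G. \<forall>y\<in>G. P x y \<ge> 0) \<and> (\<forall>x\<in>G. (P x has_sum 1) G)"

definition merw_kernel :: "'a set \<Rightarrow> 'a matrix \<Rightarrow> 'a matrix \<Rightarrow> bool" where
  "merw_kernel G A P \<longleftrightarrow> markov_kernel G P \<and>
     (\<exists>\<psi>. positive_eigenfunction G A (comb_spectral_radius G A) \<psi> \<and>
       (\<forall>x\<in>G. \<forall>y\<in>G. P x y = A x y * (\<psi> y / (comb_spectral_radius G A * \<psi> x))))"

text \<open>
  \<open>first_passage G P y n x\<close> is the probability that the chain with kernel \<open>P\<close> started at \<open>x\<close>
  visits \<open>y\<close> at time \<open>n\<close> for the first time after time \<open>0\<close>; for \<open>x = y\<close> it is the law of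
  the first return time.
\<close>

fun first_passage :: "'a set \<Rightarrow> 'a matrix \<Rightarrow> 'a \<Rightarrow> nat \<Rightarrow> 'a \<Rightarrow> real" where
  "first_passage G P y 0 x = 0"
| "first_passage G P y (Suc 0) x = P x y"
| "first_passage G P y (Suc (Suc n)) x =
     (\<Sum>\<^sub>\<infinity>z\<in>G - {y}. P x z * first_passage G P y (Suc n) z)"

text \<open>Every state is visited again almost surely, but after an infinite expected time.\<close>

definition null_recurrent :: "'a set \<Rightarrow> 'a matrix \<Rightarrow> bool" where
  "null_recurrent G P \<longleftrightarrow> markov_kernel G P \<and>
     (\<forall>x\<in>G. (\<lambda>n. first_passage G P x n x) sums 1 \<and>
             \<not> summable (\<lambda>n. real n * first_passage G P x n x))"

definition invariant_measure :: "'a set \<Rightarrow> 'a matrix \<Rightarrow> ('a \<Rightarrow> real) \<Rightarrow> bool" where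
  "invariant_measure G P \<mu> \<longleftrightarrow>
     (\<forall>x\<in>G. \<mu> x \<ge> 0) \<and> (\<exists>x\<in>G. \<mu> x \<noteq> 0) \<and>
     (\<forall>y\<in>G. ((\<lambda>x. \<mu> x * P x y) has_sum \<mu> y) G)"

text \<open>
  The identification of \<open>(0,1), \<dots>, (0,N)\<close> is realised by the representative \<open>(0,1)\<close>:
  \<open>node n k\<close> is the class of \<open>(n,k)\<close>.
\<close>

definition node :: "nat \<Rightarrow> nat \<Rightarrow> nat \<times> nat" where
  "node n k = (if n = 0 then (0, 1) else (n, k))"

abbreviation origin :: "nat \<times> nat" where
  "origin \<equiv> node 0 1"

definition spider :: "nat \<Rightarrow> (nat \<times> nat) set" where
  "spider N = {node n k | n k. 1 \<le> k \<and> k \<le> N}"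

text \<open>
  The matrix need not be symmetric: the edge from the origin to \<open>(1,k)\<close> has weight \<open>\<gamma>2 k\<close>,
  the reverse edge has weight \<open>\<gamma>3\<close>.
\<close>

definition spider_adj :: "real \<Rightarrow> (nat \<Rightarrow> real) \<Rightarrow> real \<Rightarrow> (nat \<times> nat) matrix" where
  "spider_adj \<gamma>1 \<gamma>2 \<gamma>3 x y =
     (if x = origin then
        (if y = origin then \<gamma>1 else if fst y = 1 then \<gamma>2 (snd y) else 0)
      else if y = node (fst x + 1) (snd x) \<or> y = node (fst x - 1) (snd x) then \<gamma>3
      else 0)"

end

theory Submission
  imports Defs
begin

text \<open>
  When \<open>\<Lambda> = 0\<close>, the matrix \<open>A / (2 \<gamma>3)\<close> is a Markov kernel \<open>P\<close>. A nonnegative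
  \<open>P\<close>-superharmonic function is concave along each leg, hence nondecreasing away from the origin,
  and superharmonicity at the origin forces all outgoing slopes to vanish: it is constant. This
  Liouville property yields three things at once. Positive eigenfunctions for \<open>2 \<gamma>3\<close> are
  constant; the Green function diverges at \<open>1\<close>, so that \<open>\<rho> = 2 \<gamma>3\<close>; and the probability of
  never reaching a state, extended by \<open>0\<close> at that state, is a bounded subharmonic function, hence
  zero, so the walk is recurrent. Recurrence is null because a finite expected hitting time would
  have second difference \<open>-2\<close> along a leg and so become negative.
\<close>

section \<open>Concave sequences and scaled matrix powers\<close>

text \<open>A negative slope persists by concavity, so the sequence would decrease at least linearly
  from there on and become negative.\<close>

lemma concave_nonneg_nondecreasing:
  fixes g :: "nat \<Rightarrow> real"
  assumes nonneg: "\<And>i. 0 \<le> g i"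
    and concave: "\<And>i. g (Suc (Suc i)) + g i \<le> 2 * g (Suc i)"
  shows "g i \<le> g (Suc i)"
proof (rule ccontr)
  define d where "d = g i - g (Suc i)"
  assume "\<not> g i \<le> g (Suc i)"
  then have "d > 0" by (simp add: d_def)
  have slope: "g (Suc (i + j)) - g (i + j) \<le> - d" for j
  proof (induction j)
    case (Suc j)
    then show ?case using concave[of "i + j"] by simp
  qed (simp add: d_def)
  have bound: "g (i + j) \<le> g i - real j * d" for j
  proof (induction j)
    case (Suc j)
    then show ?case using slope[of j] by (simp add: algebra_simps)
  qed simp
  obtain j where "g i < real j * d"
    using \<open>d > 0\<close> reals_Archimedean3 by blast
  then show False using bound[of j] nonneg[of "i + j"] by simp
qed

lemma mat_pow_scale:
  "mat_pow G (\<lambda>x y. c * P x y) n x y = c ^ n * mat_pow G P n x y"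
proof (induction n arbitrary: x)
  case (Suc n)
  have "mat_pow G (\<lambda>x y. c * P x y) (Suc n) x y
      = (\<Sum>\<^sub>\<infinity>z\<in>G. c ^ Suc n * (P x z * mat_pow G P n z y))"
    by (simp add: Suc mult_ac)
  then show ?case by (simp only: infsum_cmult_right') simp
qed simp

section \<open>Markov kernels with finite range\<close>

locale finite_range_kernel =
  fixes G :: "'a set" and P :: "'a matrix"
  assumes markov: "markov_kernel G P"
    and finite_range: "\<And>x. x \<in> G \<Longrightarrow> finite {y \<in> G. P x y \<noteq> 0}"
begin

section \<open>The averaging operator of the kernel\<close>

text \<open>The sum is restricted to the finite support of the row, so that limits and series pass
  through it without any domination argument.\<close>

definition avg :: "('a \<Rightarrow> real) \<Rightarrow> 'a \<Rightarrow> real" where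
  "avg h x = (\<Sum>y | y \<in> G \<and> P x y \<noteq> 0. P x y * h y)"

lemma kernel_nonneg: "x \<in> G \<Longrightarrow> y \<in> G \<Longrightarrow> 0 \<le> P x y"
  using markov by (simp add: markov_kernel_def)

lemma has_sum_avg:
  assumes "x \<in> G"
  shows "((\<lambda>y. P x y * h y) has_sum avg h x) G"
proof -
  have "((\<lambda>y. P x y * h y) has_sum avg h x) {y \<in> G. P x y \<noteq> 0}"
    unfolding avg_def by (rule has_sum_finite[OF finite_range[OF assms]])
  then show ?thesis
    by (rule has_sum_cong_neutral[THEN iffD1, rotated -1]) auto
qed

lemma avg_eqI: "x \<in> G \<Longrightarrow> ((\<lambda>y. P x y * h y) has_sum s) G \<Longrightarrow> avg h x = s"
  using has_sum_avg has_sum_unique by blast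

lemma avg_const: "x \<in> G \<Longrightarrow> avg (\<lambda>_. c) x = c"
  using markov has_sum_cmult_left[of "P x" G 1 c] by (intro avg_eqI) (auto simp: markov_kernel_def)

lemma avg_cong: "(\<And>y. y \<in> G \<Longrightarrow> h y = h' y) \<Longrightarrow> avg h x = avg h' x"
  unfolding avg_def by (intro sum.cong) auto

lemma avg_diff: "avg (\<lambda>y. h y - h' y) x = avg h x - avg h' x"
  unfolding avg_def by (simp add: right_diff_distrib sum_subtractf)

lemma avg_mono: "x \<in> G \<Longrightarrow> (\<And>y. y \<in> G \<Longrightarrow> h y \<le> h' y) \<Longrightarrow> avg h x \<le> avg h' x"
  unfolding avg_def by (intro sum_mono mult_left_mono) (auto simp: kernel_nonneg)

lemma avg_nonneg: "x \<in> G \<Longrightarrow> (\<And>y. y \<in> G \<Longrightarrow> 0 \<le> h y) \<Longrightarrow> 0 \<le> avg h x"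
  unfolding avg_def by (intro sum_nonneg mult_nonneg_nonneg) (auto simp: kernel_nonneg)

lemma avg_ge_term:
  assumes "x \<in> G" "z \<in> G" "\<And>y. y \<in> G \<Longrightarrow> 0 \<le> h y"
  shows "P x z * h z \<le> avg h x"
proof (cases "P x z = 0")
  case True
  then show ?thesis using avg_nonneg[of x h] assms by simp
next
  case False
  then show ?thesis unfolding avg_def using assms finite_range[OF assms(1)]
    by (intro member_le_sum) (auto simp: kernel_nonneg)
qed

lemma avg_tendsto:
  assumes "\<And>y. y \<in> G \<Longrightarrow> (\<lambda>n. h n y) \<longlonglongrightarrow> l y"
  shows "(\<lambda>n. avg (h n) x) \<longlonglongrightarrow> avg l x"
  unfolding avg_def using assms by (intro tendsto_sum tendsto_mult) auto

lemma avg_sums: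
  assumes "\<And>y. y \<in> G \<Longrightarrow> P x y \<noteq> 0 \<Longrightarrow> (\<lambda>n. h n y) sums l y"
  shows "(\<lambda>n. avg (h n) x) sums avg l x"
  unfolding avg_def using assms by (intro sums_sum sums_mult) auto

text \<open>Rewrites the sum over \<open>G - {y}\<close> in \<open>first_passage\<close> as an
  average over all of \<open>G\<close>, moving the killing at \<open>y\<close> from the index set
  into the function.\<close>

lemma avg_killed:
  assumes "x \<in> G"
  shows "(\<Sum>\<^sub>\<infinity>z\<in>G - {y}. P x z * h z) = avg (\<lambda>z. if z = y then 0 else h z) x"
proof -
  have "((\<lambda>z. P x z * h z) has_sum avg (\<lambda>z. if z = y then 0 else h z) x) (G - {y})"
    by (rule has_sum_cong_neutral[THEN iffD1, rotated -1, OF has_sum_avg[OF assms]]) auto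
  then show ?thesis by (rule infsumI)
qed

lemma avg_point:
  assumes "x \<in> G" "y \<in> G"
  shows "avg (\<lambda>z. if z = y then 1 else 0) x = P x y"
proof (rule avg_eqI[OF assms(1)])
  have "((\<lambda>z. P x z * (if z = y then 1 else 0)) has_sum P x y) {y}"
    using has_sum_finite[of "{y}" "\<lambda>z. P x z * (if z = y then 1 else 0)"] by simp
  then show "((\<lambda>z. P x z * (if z = y then 1 else 0)) has_sum P x y) G"
    by (rule has_sum_cong_neutral[THEN iffD1, rotated -1]) (use assms in auto)
qed

lemma mat_pow_Suc_avg:
  "x \<in> G \<Longrightarrow> mat_pow G P (Suc n) x y = avg (\<lambda>z. mat_pow G P n z y) x"
  using infsumI[OF has_sum_avg] by simp

lemma mat_pow_bounds:
  "x \<in> G \<Longrightarrow> 0 \<le> mat_pow G P n x y \<and> mat_pow G P n x y \<le> 1"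
proof (induction n arbitrary: x)
  case (Suc n)
  have "avg (\<lambda>z. mat_pow G P n z y) x \<le> avg (\<lambda>_. 1) x"
    using Suc by (intro avg_mono) auto
  moreover have "0 \<le> avg (\<lambda>z. mat_pow G P n z y) x"
    using Suc by (intro avg_nonneg) auto
  ultimately show ?case
    using Suc.prems by (simp only: mat_pow_Suc_avg avg_const)
qed simp

section \<open>Survival probabilities and first-passage laws\<close>

text \<open>The probability of not visiting \<open>y\<close> at the times \<open>1, \<dots>, n\<close>.\<close>

primrec survival :: "'a \<Rightarrow> nat \<Rightarrow> 'a \<Rightarrow> real" where
  "survival y 0 = (\<lambda>x. 1)"
| "survival y (Suc n) = avg (\<lambda>z. if z = y then 0 else survival y n z)"

lemma survival_nonneg: "x \<in> G \<Longrightarrow> 0 \<le> survival y n x"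
  by (induction n arbitrary: x) (auto intro: avg_nonneg)

lemma survival_decreasing: "x \<in> G \<Longrightarrow> survival y (Suc n) x \<le> survival y n x"
proof (induction n arbitrary: x)
  case 0
  have "avg (\<lambda>z. if z = y then 0 else 1) x \<le> avg (\<lambda>_. 1) x"
    using 0 by (intro avg_mono) auto
  then show ?case using 0 by (simp add: avg_const cong: if_cong)
next
  case (Suc n)
  then show ?case
    unfolding survival.simps(2)[of y "Suc n"] survival.simps(2)[of y n]
    by (intro avg_mono) (auto simp del: survival.simps)
qed

lemma survival_le_1: "x \<in> G \<Longrightarrow> survival y n x \<le> 1"
proof (induction n)
  case (Suc n)
  then show ?case using survival_decreasing[of x y n] by linarith
qed simp

text \<open>One step towards \<open>z\<close> is one way to avoid \<open>y\<close>. This carries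
  summability of the survival probabilities from \<open>x\<close> to a neighbour
  \<open>z\<close>.\<close>

lemma survival_ge_step:
  assumes "x \<in> G" "z \<in> G" "z \<noteq> y"
  shows "P x z * survival y n z \<le> survival y (Suc n) x"
  using avg_ge_term[of x z "\<lambda>z. if z = y then 0 else survival y n z"] assms
  by (simp add: survival_nonneg)

text \<open>For n = 0 the difference is one minus the mass of the row off \<open>y\<close>.
  Afterwards both sides obey the same recursion, killed at \<open>y\<close>, which is
  linear.\<close>

lemma first_passage_survival:
  assumes "x \<in> G" "y \<in> G"
  shows "first_passage G P y (Suc n) x = survival y n x - survival y (Suc n) x"
  using assms(1)
proof (induction n arbitrary: x)
  case 0
  have "avg (\<lambda>z. if z = y then 0 else 1) x = avg (\<lambda>z. 1 - (if z = y then 1 else 0)) x"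
    by (intro avg_cong) auto
  then show ?case using 0 assms(2) by (simp add: avg_diff avg_const avg_point cong: if_cong)
next
  case (Suc n)
  have "first_passage G P y (Suc (Suc n)) x
      = avg (\<lambda>z. if z = y then 0 else first_passage G P y (Suc n) z) x"
    by (simp add: avg_killed Suc.prems)
  also have "\<dots> = avg (\<lambda>z. (if z = y then 0 else survival y n z)
                      - (if z = y then 0 else survival y (Suc n) z)) x"
    using Suc.IH by (intro avg_cong) (auto simp del: survival.simps)
  finally show ?case by (simp add: avg_diff del: first_passage.simps)
qed

lemma first_passage_nonneg:
  assumes "x \<in> G" "y \<in> G"
  shows "0 \<le> first_passage G P y n x"
  using first_passage_survival[OF assms] survival_decreasing[OF assms(1)]
  by (cases n) (auto simp del: survival.simps)

lemma sum_first_passage: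
  assumes "x \<in> G" "y \<in> G"
  shows "(\<Sum>i<Suc n. first_passage G P y i x) = 1 - survival y n x"
proof (induction n)
  case (Suc n)
  then show ?case
    unfolding sum.lessThan_Suc[of _ "Suc n"] first_passage_survival[OF assms] by simp
qed simp

text \<open>Summation by parts: the truncated mean is the sum of the tails minus a boundary
  term.\<close>

lemma sum_time_first_passage:
  assumes "x \<in> G" "y \<in> G"
  shows "(\<Sum>i<Suc n. real i * first_passage G P y i x)
       = (\<Sum>i<n. survival y i x) - real n * survival y n x"
proof (induction n)
  case (Suc n)
  then show ?case
    unfolding sum.lessThan_Suc[of _ "Suc n"] first_passage_survival[OF assms]
    by (simp add: algebra_simps del: survival.simps)
qed simp

text \<open>The mean is the sum of the tails, but the boundary term n times
  \<open>survival y n x\<close> is not known to vanish. It is avoided by fixing the number n of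
  tails and sending the truncation time k to infinity, where recurrence removes the
  correction.\<close>

lemma summable_survival:
  assumes xy: "x \<in> G" "y \<in> G"
    and recurrent: "(\<lambda>n. survival y n x) \<longlonglongrightarrow> 0"
    and mean: "summable (\<lambda>n. real n * first_passage G P y n x)"
  shows "summable (\<lambda>n. survival y n x)"
proof (rule summableI_nonneg_bounded)
  define S where "S = (\<Sum>n. real n * first_passage G P y n x)"
  have decreasing: "survival y n x \<le> survival y m x" if "m \<le> n" for m n
    using lift_Suc_antimono_le[of "\<lambda>n. survival y n x" m n] survival_decreasing[OF xy(1)] that
    by blast
  have bound: "(\<Sum>i<n. survival y i x) - real n * survival y k x \<le> S" if "n \<le> k" for n k
  proof -
    have "(\<Sum>i<n. survival y i x) - real n * survival y k x
        = (\<Sum>i<n. survival y i x - survival y k x)"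
      by (simp add: sum_subtractf)
    \<comment> \<open>The survival probabilities decrease in time, so the additional summands with
      index below k are nonnegative.\<close>
    also have "\<dots> \<le> (\<Sum>i<k. survival y i x - survival y k x)"
      using that decreasing by (intro sum_mono2) auto
    also have "\<dots> = (\<Sum>i<Suc k. real i * first_passage G P y i x)"
      unfolding sum_time_first_passage[OF xy] by (simp add: sum_subtractf)
    also have "\<dots> \<le> S"
      unfolding S_def by (intro sum_le_suminf mean) (auto simp: first_passage_nonneg xy)
    finally show ?thesis .
  qed
  show "(\<Sum>i<n. survival y i x) \<le> S" for n
  proof (rule LIMSEQ_le_const2)
    show "(\<lambda>k. (\<Sum>i<n. survival y i x) - real n * survival y k x)
        \<longlonglongrightarrow> (\<Sum>i<n. survival y i x)"
      using tendsto_diff[OF tendsto_const tendsto_mult_right_zero[OF recurrent]] by simp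
    show "\<exists>K. \<forall>k\<ge>K. (\<Sum>i<n. survival y i x) - real n * survival y k x \<le> S"
      using bound by blast
  qed
qed (rule survival_nonneg[OF xy(1)])

section \<open>The Liouville property, recurrence and the Green function\<close>

text \<open>For irreducible chains this property is equivalent to recurrence. Here it serves as the
  one analytic input that a concrete kernel has to supply.\<close>

definition liouville :: bool where
  "liouville \<longleftrightarrow> (\<forall>h. (\<forall>x\<in>G. 0 \<le> h x \<and> avg h x \<le> h x) \<longrightarrow> (\<forall>x\<in>G. \<forall>y\<in>G. h x = h y))"

lemma liouvilleD:
  assumes "liouville" "\<And>x. x \<in> G \<Longrightarrow> 0 \<le> h x" "\<And>x. x \<in> G \<Longrightarrow> avg h x \<le> h x" "x \<in> G" "y \<in> G"
  shows "h x = h y"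
  using assms unfolding liouville_def by blast

text \<open>Irreducibility is phrased with closed sets instead of paths, which suits
  \<open>green_diverges\<close>: the states with a convergent Green series form a closed
  set.\<close>

definition irreducible_kernel :: bool where
  "irreducible_kernel \<longleftrightarrow>
     (\<forall>S\<subseteq>G. S \<noteq> {} \<longrightarrow> (\<forall>x\<in>S. \<forall>y\<in>G. P x y \<noteq> 0 \<longrightarrow> y \<in> S) \<longrightarrow> S = G)"

lemma survival_tendsto_0:
  assumes "liouville" "x \<in> G" "y \<in> G"
  shows "(\<lambda>n. survival y n x) \<longlonglongrightarrow> 0"
proof -
  define u where "u = (\<lambda>x. lim (\<lambda>n. survival y n x))"
  have lim: "(\<lambda>n. survival y n z) \<longlonglongrightarrow> u z" if "z \<in> G" for z
  proof -
    have "decseq (\<lambda>n. survival y n z)"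
      using survival_decreasing[OF that] by (rule decseq_SucI)
    moreover have "\<forall>n. 0 \<le> survival y n z"
      using survival_nonneg[OF that] by blast
    ultimately obtain L where "(\<lambda>n. survival y n z) \<longlonglongrightarrow> L"
      using decseq_convergent by blast
    then show ?thesis unfolding u_def by (simp add: limI)
  qed
  have u_bounds: "0 \<le> u z" "u z \<le> 1" if "z \<in> G" for z
    using LIMSEQ_le_const[OF lim[OF that]] LIMSEQ_le_const2[OF lim[OF that]]
      survival_nonneg[OF that] survival_le_1[OF that] by blast+
  \<comment> \<open>The limit \<open>u\<close> need not vanish at \<open>y\<close>, where it is the
    probability of never returning. Killing it there gives the function to which the Liouville
    property applies.\<close>
  define v where "v = (\<lambda>z. if z = y then 0 else u z)"
  have avg_v: "avg v z = u z" if "z \<in> G" for z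
  proof (rule LIMSEQ_unique)
    show "(\<lambda>n. survival y (Suc n) z) \<longlonglongrightarrow> avg v z"
      unfolding survival.simps v_def by (intro avg_tendsto) (auto simp: lim)
    show "(\<lambda>n. survival y (Suc n) z) \<longlonglongrightarrow> u z"
      using lim[OF that] by (rule LIMSEQ_Suc)
  qed
  have v_eq: "1 - v z = 1 - v y" if "z \<in> G" for z
  proof (rule liouvilleD[OF assms(1) _ _ that assms(3)])
    fix z assume z: "z \<in> G"
    show "0 \<le> 1 - v z" using u_bounds[OF z] by (simp add: v_def)
    \<comment> \<open>The average of \<open>v\<close> is \<open>u\<close>, and \<open>v\<close> lies
      below \<open>u\<close>; hence \<open>v\<close> is subharmonic.\<close>
    show "avg (\<lambda>z. 1 - v z) z \<le> 1 - v z"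
      using u_bounds[OF z] u_bounds[OF assms(3)] z by (simp add: avg_diff avg_const avg_v) (simp add: v_def)
  qed
  \<comment> \<open>By \<open>v_eq\<close> and the value 0 at the pole, \<open>v\<close> vanishes on
    \<open>G\<close>; averaging once more gives \<open>u x = 0\<close>, even when \<open>x\<close>
    is \<open>y\<close> itself.\<close>
  have "u x = avg (\<lambda>_. 0) x"
    unfolding avg_v[OF assms(2), symmetric]
    by (rule avg_cong) (use v_eq in \<open>simp add: v_def\<close>)
  then show ?thesis using lim[OF assms(2)] assms(2) by (simp add: avg_const)
qed

lemma first_passage_sums_1:
  assumes "liouville" "x \<in> G" "y \<in> G"
  shows "(\<lambda>n. first_passage G P y n x) sums 1"
proof -
  have "(\<lambda>n. \<Sum>i<Suc n. first_passage G P y i x) \<longlonglongrightarrow> 1 - 0"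
    unfolding sum_first_passage[OF assms(2,3)]
    by (intro tendsto_intros survival_tendsto_0 assms)
  then show ?thesis unfolding sums_def by (subst (asm) filterlim_sequentially_Suc) simp
qed

text \<open>A finite Green function would be superharmonic, hence constant, contradicting its strict
  superharmonicity at the pole \<open>y\<close>.\<close>

lemma green_diverges:
  assumes "liouville" "irreducible_kernel" "x \<in> G" "y \<in> G"
  shows "\<not> summable (\<lambda>n. mat_pow G P n x y)"
proof
  define S where "S = {x \<in> G. summable (\<lambda>n. mat_pow G P n x y)}"
  assume "summable (\<lambda>n. mat_pow G P n x y)"
  then have "S \<noteq> {}" using assms(3) by (auto simp: S_def)
  \<comment> \<open>In the one-step expansion of the convergent series at \<open>x\<close>, the
    contribution of \<open>z\<close> alone is bounded by the whole.\<close>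
  have closed: "z \<in> S" if "x \<in> S" "z \<in> G" "P x z \<noteq> 0" for x z
  proof -
    have x: "x \<in> G" "summable (\<lambda>n. mat_pow G P n x y)" using that by (auto simp: S_def)
    have "summable (\<lambda>n. P x z * mat_pow G P n z y)"
    proof (rule summable_comparison_test')
      show "summable (\<lambda>n. mat_pow G P (Suc n) x y)"
        using x(2) by (subst summable_Suc_iff)
      show "norm (P x z * mat_pow G P n z y) \<le> mat_pow G P (Suc n) x y" for n
        unfolding mat_pow_Suc_avg[OF x(1)]
        using avg_ge_term[of x z "\<lambda>z. mat_pow G P n z y"] x(1) that(2)
        by (simp add: mat_pow_bounds kernel_nonneg)
    qed
    then show ?thesis using that by (simp add: S_def)
  qed
  have "S = G"
  proof (rule assms(2)[unfolded irreducible_kernel_def, rule_format])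
    show "S \<subseteq> G" by (auto simp: S_def)
  qed (fact \<open>S \<noteq> {}\<close>, rule closed)
  then have summable: "summable (\<lambda>n. mat_pow G P n z y)" if "z \<in> G" for z
    using that by (auto simp: S_def)
  define g where "g = (\<lambda>z. \<Sum>n. mat_pow G P n z y)"
  have sums: "(\<lambda>n. mat_pow G P n z y) sums g z" if "z \<in> G" for z
    unfolding g_def by (rule summable_sums[OF summable[OF that]])
  have avg_g: "g z = (if z = y then 1 else 0) + avg g z" if "z \<in> G" for z
  proof -
    have "(\<lambda>n. mat_pow G P (Suc n) z y) sums avg g z"
      unfolding mat_pow_Suc_avg[OF that] by (rule avg_sums) (rule sums)
    then have "(\<lambda>n. mat_pow G P n z y) sums (avg g z + mat_pow G P 0 z y)"
      by (subst (asm) sums_Suc_iff) simp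
    then show ?thesis using sums_unique2[OF sums[OF that]] by simp
  qed
  have const: "g z = g y" if "z \<in> G" for z
  proof (rule liouvilleD[OF assms(1) _ _ that assms(4)])
    fix z assume z: "z \<in> G"
    show "0 \<le> g z" unfolding g_def using summable[OF z] mat_pow_bounds[OF z] by (simp add: suminf_nonneg)
    show "avg g z \<le> g z" using avg_g[OF z] by (simp split: if_splits)
  qed
  \<comment> \<open>A constant \<open>g\<close> is its own average, so \<open>avg_g\<close> at the
    pole would read \<open>g y = 1 + g y\<close>.\<close>
  have "avg g y = avg (\<lambda>_. g y) y" by (rule avg_cong) (rule const)
  then show False using avg_g[OF assms(4)] avg_const[OF assms(4)] by simp
qed

section \<open>Radius of convergence and spectral radius\<close>

text \<open>At the point 1/c the series is the Green series, which diverges. Below 1/c a geometric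
  series dominates, since the powers of \<open>P\<close> have entries at most 1.\<close>

lemma conv_radius_scaled:
  assumes "liouville" "irreducible_kernel" "x \<in> G" "y \<in> G" "c > 0"
  shows "conv_radius (\<lambda>n. mat_pow G (\<lambda>x y. c * P x y) n x y) = ereal (1 / c)"
proof (rule antisym)
  have "conv_radius (\<lambda>n. c ^ n * mat_pow G P n x y) \<le> norm (1 / c)"
    using green_diverges[OF assms(1-4)] assms(5)
    by (intro conv_radius_leI') (simp add: power_divide)
  then show "conv_radius (\<lambda>n. mat_pow G (\<lambda>x y. c * P x y) n x y) \<le> ereal (1 / c)"
    using assms(5) by (simp add: mat_pow_scale)
  show "ereal (1 / c) \<le> conv_radius (\<lambda>n. mat_pow G (\<lambda>x y. c * P x y) n x y)"
    unfolding mat_pow_scale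
  proof (rule conv_radius_geI_ex')
    fix r :: real assume r: "0 < r" "ereal r < ereal (1 / c)"
    show "summable (\<lambda>n. c ^ n * mat_pow G P n x y * of_real r ^ n)"
    proof (rule summable_comparison_test')
      show "summable (\<lambda>n. (c * r) ^ n)"
        using r assms(5) by (intro summable_geometric) (simp add: field_simps)
      show "norm (c ^ n * mat_pow G P n x y * of_real r ^ n) \<le> (c * r) ^ n" for n
        using mat_pow_bounds[OF assms(3)] r(1) assms(5)
        by (simp add: power_mult_distrib abs_mult mult_left_le mult_right_mono)
    qed
  qed
qed

lemma comb_spectral_radius_scaled:
  assumes "liouville" "irreducible_kernel" "G \<noteq> {}" "c > 0"
  shows "comb_spectral_radius G (\<lambda>x y. c * P x y) = c"
  unfolding comb_spectral_radius_def
  \<comment> \<open>A nonempty \<open>G\<close> is what makes the number described by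
    \<open>THE\<close> unique.\<close>
  using assms by (intro the_equality) (auto simp: conv_radius_scaled)

end

section \<open>The spider walk at the critical parameters\<close>

locale critical_spider =
  fixes N :: nat and \<gamma>1 \<gamma>3 :: real and \<gamma>2 :: "nat \<Rightarrow> real"
  assumes legs: "N \<ge> 1"
    and loop_nonneg: "\<gamma>1 \<ge> 0"
    and exit_pos: "\<And>k. 1 \<le> k \<Longrightarrow> k \<le> N \<Longrightarrow> \<gamma>2 k > 0"
    and leg_pos: "\<gamma>3 > 0"
    and critical: "2 * \<gamma>3 - \<gamma>1 - (\<Sum>k=1..N. \<gamma>2 k) = 0"
begin

section \<open>Transitions of the spider walk\<close>

text \<open>At criticality \<open>2 * \<gamma>3\<close> is the common row sum of the adjacency
  matrix, and it turns out to be the spectral radius.\<close>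

definition walk :: "(nat \<times> nat) matrix" where
  "walk x y = spider_adj \<gamma>1 \<gamma>2 \<gamma>3 x y / (2 * \<gamma>3)"

lemma spider_cases:
  assumes "x \<in> spider N"
  obtains "x = origin" | n k where "x = node (Suc n) k" "1 \<le> k" "k \<le> N"
proof -
  obtain n k where "x = node n k" "1 \<le> k" "k \<le> N" using assms by (auto simp: spider_def)
  then show thesis using that by (cases n) (auto simp: node_def)
qed

lemma node_in_spider: "1 \<le> k \<Longrightarrow> k \<le> N \<Longrightarrow> node n k \<in> spider N"
  by (auto simp: spider_def)

lemma origin_in_spider: "origin \<in> spider N"
  using legs by (auto intro: node_in_spider)

lemma node_0: "node 0 k = origin"
  by (simp add: node_def)

lemma node_Suc: "node (Suc n) k = (Suc n, k)"
  by (simp add: node_def)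

lemma node_eq_iff:
  "node (Suc n) k = node (Suc m) j \<longleftrightarrow> n = m \<and> k = j"
  "node (Suc n) k \<noteq> node 0 j"
  "node 0 j \<noteq> node (Suc n) k"
  by (auto simp: node_def)

text \<open>The two neighbours of a leg vertex are distinct, so sums over them really have two
  terms.\<close>

lemma node_ne: "node n k \<noteq> node (Suc (Suc n)) k"
  by (simp add: node_def)

lemma walk_leg:
  "walk (node (Suc n) k) y = (if y = node n k \<or> y = node (Suc (Suc n)) k then 1 / 2 else 0)"
proof -
  have "spider_adj \<gamma>1 \<gamma>2 \<gamma>3 (node (Suc n) k) y
      = (if y = node n k \<or> y = node (Suc (Suc n)) k then \<gamma>3 else 0)"
    unfolding spider_adj_def by (simp add: node_Suc) (simp add: node_def)
  then show ?thesis using leg_pos by (simp add: walk_def)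
qed

lemma walk_origin_origin: "walk (node 0 i) (node 0 j) = \<gamma>1 / (2 * \<gamma>3)"
  by (simp add: walk_def spider_adj_def node_def)

lemma walk_origin_leg: "walk (node 0 j) (node (Suc n) k) = (if n = 0 then \<gamma>2 k / (2 * \<gamma>3) else 0)"
  by (simp add: walk_def spider_adj_def node_def)

lemma sum_origin_and_exits:
  "(\<Sum>x\<in>insert origin (node 1 ` {1..N}). f x) = f origin + (\<Sum>k=1..N. f (node 1 k))"
proof -
  have "(\<Sum>x\<in>node 1 ` {1..N}. f x) = (\<Sum>k=1..N. f (node 1 k))"
    by (subst sum.reindex) (auto simp: inj_on_def node_Suc)
  moreover have "origin \<notin> node 1 ` {1..N}"
    by (auto simp: node_def)
  ultimately show ?thesis by simp
qed

lemma origin_and_exits_subset: "insert origin (node 1 ` {1..N}) \<subseteq> spider N"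
  using origin_in_spider node_in_spider by (simp add: image_subset_iff)

lemma not_origin_or_exit:
  assumes "x \<in> spider N" "x \<notin> insert origin (node 1 ` {1..N})"
  obtains n k where "x = node (Suc (Suc n)) k" "1 \<le> k" "k \<le> N"
  using assms(1)
proof (cases rule: spider_cases)
  case 1
  then show ?thesis using assms(2) by blast
next
  case (2 n k)
  then have "n \<noteq> 0" using assms(2) by auto
  then show ?thesis using 2 that by (cases n) auto
qed

lemma has_sum_supported:
  fixes f :: "nat \<times> nat \<Rightarrow> real"
  assumes "finite S" "S \<subseteq> spider N" "\<And>x. x \<in> spider N \<Longrightarrow> x \<notin> S \<Longrightarrow> f x = 0" "sum f S = s"
  shows "(f has_sum s) (spider N)"
proof -
  have "(f has_sum s) S" using has_sum_finite[OF assms(1), of f] assms(4) by simp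
  then show ?thesis
    by (rule has_sum_cong_neutral[THEN iffD1, rotated -1]) (use assms(2,3) in auto)
qed

lemma has_sum_leg:
  assumes "1 \<le> k" "k \<le> N"
  shows "((\<lambda>y. walk (node (Suc n) k) y * h y) has_sum
           (h (node n k) + h (node (Suc (Suc n)) k)) / 2) (spider N)"
proof (rule has_sum_supported)
  show "{node n k, node (Suc (Suc n)) k} \<subseteq> spider N"
    using node_in_spider[OF assms] by blast
  show "(\<Sum>y\<in>{node n k, node (Suc (Suc n)) k}. walk (node (Suc n) k) y * h y)
      = (h (node n k) + h (node (Suc (Suc n)) k)) / 2"
    using node_ne[of n k] by (simp add: walk_leg)
qed (auto simp: walk_leg)

lemma has_sum_origin:
  "((\<lambda>y. walk origin y * h y) has_sum
     (\<gamma>1 * h origin + (\<Sum>k=1..N. \<gamma>2 k * h (node 1 k))) / (2 * \<gamma>3)) (spider N)"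
proof (rule has_sum_supported[OF _ origin_and_exits_subset])
  show "walk origin y * h y = 0"
    if "y \<in> spider N" "y \<notin> insert origin (node 1 ` {1..N})" for y
    using not_origin_or_exit[OF that] by (metis walk_origin_leg nat.distinct(1) mult_zero_left)
  have "(\<Sum>k=1..N. walk origin (node 1 k) * h (node 1 k))
      = (\<Sum>k=1..N. \<gamma>2 k * h (node 1 k)) / (2 * \<gamma>3)"
    unfolding One_nat_def walk_origin_leg by (simp add: sum_divide_distrib)
  then show "(\<Sum>y\<in>insert origin (node 1 ` {1..N}). walk origin y * h y)
      = (\<gamma>1 * h origin + (\<Sum>k=1..N. \<gamma>2 k * h (node 1 k))) / (2 * \<gamma>3)"
    unfolding sum_origin_and_exits walk_origin_origin by (simp add: add_divide_distrib)
qed simp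

lemma walk_nonneg:
  assumes "x \<in> spider N" "y \<in> spider N"
  shows "0 \<le> walk x y"
  using assms(1)
proof (cases rule: spider_cases)
  case 1
  show ?thesis
    using assms(2)
  proof (cases rule: spider_cases)
    case 1
    then show ?thesis
      using \<open>x = origin\<close> loop_nonneg leg_pos by (simp add: walk_origin_origin)
  next
    case (2 n k)
    then show ?thesis
      using \<open>x = origin\<close> exit_pos[of k] leg_pos by (simp add: walk_origin_leg)
  qed
qed (simp add: walk_leg)

lemma walk_markov: "markov_kernel (spider N) walk"
  unfolding markov_kernel_def
proof (intro conjI ballI walk_nonneg)
  fix x assume "x \<in> spider N"
  then show "(walk x has_sum 1) (spider N)"
  proof (cases rule: spider_cases)
    \<comment> \<open>At the origin the row sum is 1 exactly because \<Lambda> = 0.\<close>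
    case 1
    then show ?thesis
      using has_sum_origin[of "\<lambda>_. 1"] critical leg_pos by (simp add: field_simps)
  next
    case (2 n k)
    then show ?thesis using has_sum_leg[of k n "\<lambda>_. 1"] by simp
  qed
qed

lemma finite_support:
  assumes "x \<in> spider N"
  shows "finite {y \<in> spider N. walk x y \<noteq> 0}"
  using assms
proof (cases rule: spider_cases)
  case 1
  have "walk origin y = 0"
    if "y \<in> spider N" "y \<notin> insert origin (node 1 ` {1..N})" for y
    using not_origin_or_exit[OF that] by (metis walk_origin_leg nat.distinct(1))
  then have "{y \<in> spider N. walk x y \<noteq> 0} \<subseteq> insert origin (node 1 ` {1..N})"
    using 1 by blast
  then show ?thesis by (rule finite_subset) simp
next
  case (2 n k)
  then have "{y \<in> spider N. walk x y \<noteq> 0} \<subseteq> {node n k, node (Suc (Suc n)) k}"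
    by (auto simp: walk_leg split: if_splits)
  then show ?thesis by (rule finite_subset) simp
qed

sublocale finite_range_kernel "spider N" walk
  using walk_markov finite_support by unfold_locales

section \<open>Liouville property and irreducibility of the spider walk\<close>

lemma avg_leg:
  "1 \<le> k \<Longrightarrow> k \<le> N \<Longrightarrow>
    avg h (node (Suc n) k) = (h (node n k) + h (node (Suc (Suc n)) k)) / 2"
  by (intro avg_eqI has_sum_leg node_in_spider)

lemma avg_origin:
  "avg h origin = (\<gamma>1 * h origin + (\<Sum>k=1..N. \<gamma>2 k * h (node 1 k))) / (2 * \<gamma>3)"
  by (intro avg_eqI has_sum_origin origin_in_spider)

lemma superharmonic_const:
  assumes nonneg: "\<And>x. x \<in> spider N \<Longrightarrow> 0 \<le> h x"
    and super: "\<And>x. x \<in> spider N \<Longrightarrow> avg h x \<le> h x"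
    and x: "x \<in> spider N"
  shows "h x = h origin"
proof -
  have concave: "h (node (Suc (Suc i)) k) + h (node i k) \<le> 2 * h (node (Suc i) k)"
    if "1 \<le> k" "k \<le> N" for i k
    using super[OF node_in_spider[OF that, of "Suc i"]] avg_leg[OF that, of h i] by simp
  have incr: "h (node i k) \<le> h (node (Suc i) k)" if "1 \<le> k" "k \<le> N" for i k
    by (rule concave_nonneg_nondecreasing[of "\<lambda>i. h (node i k)"])
      (use that concave nonneg node_in_spider in auto)
  have slopes_nonneg: "0 \<le> \<gamma>2 k * (h (node 1 k) - h origin)" if "k \<in> {1..N}" for k
    using exit_pos[of k] incr[of k 0] that by (simp add: node_0[of k])
  \<comment> \<open>The weighted sum of the slopes leaving the origin is a multiple of the drift of
    \<open>h\<close> there: \<open>critical\<close> absorbs the loop weight. Superharmonicity makes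
    it nonpositive, while each summand is nonnegative.\<close>
  have "(\<Sum>k=1..N. \<gamma>2 k * (h (node 1 k) - h origin))
      = (\<Sum>k=1..N. \<gamma>2 k * h (node 1 k)) - (\<Sum>k=1..N. \<gamma>2 k) * h origin"
    by (simp add: right_diff_distrib sum_subtractf sum_distrib_right)
  also have "\<dots> = 2 * \<gamma>3 * (avg h origin - h origin)"
  proof -
    have S: "(\<Sum>k=1..N. \<gamma>2 k) = 2 * \<gamma>3 - \<gamma>1" using critical by simp
    show ?thesis using leg_pos unfolding avg_origin S by (simp add: field_simps)
  qed
  also have "\<dots> \<le> 0"
    using super[OF origin_in_spider] leg_pos by (simp add: mult_le_0_iff)
  finally have "(\<Sum>k=1..N. \<gamma>2 k * (h (node 1 k) - h origin)) = 0"
    using sum_nonneg[OF slopes_nonneg] by (rule antisym)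
  then have flat: "\<forall>k\<in>{1..N}. \<gamma>2 k * (h (node 1 k) - h origin) = 0"
    by (subst (asm) sum_nonneg_eq_0_iff) (use slopes_nonneg in auto)
  then have first: "h (node 1 k) = h origin" if "1 \<le> k" "k \<le> N" for k
  proof -
    have "\<gamma>2 k * (h (node 1 k) - h origin) = 0" using flat that by simp
    then show ?thesis using exit_pos[OF that] by simp
  qed
  \<comment> \<open>Carrying two consecutive values makes the induction work: after a zero slope,
    concavity bounds the next slope above by 0 and \<open>incr\<close> bounds it below.\<close>
  have leg: "h (node i k) = h origin \<and> h (node (Suc i) k) = h origin" if "1 \<le> k" "k \<le> N" for i k
  proof (induction i)
    case 0
    then show ?case using first[OF that] by (simp add: node_0[of k])
  next
    case (Suc i)
    then show ?case using concave[OF that, of i] incr[OF that, of "Suc i"] by simp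
  qed
  show ?thesis using x leg by (auto simp: spider_def)
qed

lemma liouville: liouville
  unfolding liouville_def using superharmonic_const by metis

lemma walk_out:
  assumes "1 \<le> k" "k \<le> N"
  shows "walk (node n k) (node (Suc n) k) > 0"
proof (cases n)
  case 0
  then show ?thesis using exit_pos[OF assms] leg_pos by (simp add: walk_origin_leg)
qed (simp add: walk_leg)

lemma walk_in: "walk (node (Suc n) k) (node n k) > 0"
  by (simp add: walk_leg)

text \<open>From any of its states a closed set reaches the origin by inward steps, and from there
  all legs by outward steps.\<close>

lemma irreducible: irreducible_kernel
  unfolding irreducible_kernel_def
proof (intro allI impI)
  fix S assume S: "S \<subseteq> spider N" "S \<noteq> {}"
    and closed: "\<forall>x\<in>S. \<forall>y\<in>spider N. walk x y \<noteq> 0 \<longrightarrow> y \<in> S"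
  have down: "origin \<in> S" if "node n k \<in> S" "1 \<le> k" "k \<le> N" for n k
    using that
  proof (induction n)
    case (Suc n)
    then have "node n k \<in> S"
      using closed walk_in[of n k] node_in_spider by (metis less_irrefl)
    then show ?case using Suc by blast
  qed (simp add: node_0[of k])
  obtain x where "x \<in> S" using S by blast
  then have origin: "origin \<in> S" using down S(1) by (auto simp: spider_def)
  have up: "node n k \<in> S" if "1 \<le> k" "k \<le> N" for n k
  proof (induction n)
    case 0
    then show ?case using origin by (simp add: node_0[of k])
  next
    case (Suc n)
    then show ?case
      using closed walk_out[OF that, of n] node_in_spider[OF that] by (metis less_irrefl)
  qed
  then show "S = spider N" using S(1) by (auto simp: spider_def)
qed

section \<open>Null recurrence\<close>

text \<open>In the proof, \<open>w i\<close> is the expected hitting time of \<open>(m, j)\<close> from \<open>(m + i, j)\<close>.\<close>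

lemma mean_return_time_infinite:
  assumes "1 \<le> j" "j \<le> N"
  shows "\<not> summable (\<lambda>n. real n * first_passage (spider N) walk (node m j) n (node m j))"
proof
  let ?y = "node m j"
  \<comment> \<open>The value 0 at \<open>i = 0\<close> encodes that the target is already hit,
    whereas \<open>survival\<close> started at the target concerns the return time.\<close>
  define s where "s = (\<lambda>i n. if i = 0 then 0 else survival ?y n (node (m + i) j))"
  have in_spider: "node n j \<in> spider N" for n using assms by (rule node_in_spider)
  have node_ne_y: "node (m + Suc i) j \<noteq> ?y" for i by (simp add: node_def)
  assume "summable (\<lambda>n. real n * first_passage (spider N) walk ?y n ?y)"
  then have "summable (\<lambda>n. survival ?y n ?y)"
    by (intro summable_survival survival_tendsto_0 liouville in_spider)
  \<comment> \<open>Summability spreads outwards along the leg because each outward step has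
    positive probability.\<close>
  moreover have "summable (\<lambda>n. survival ?y n (node (m + Suc i) j))"
    if "summable (\<lambda>n. survival ?y n (node (m + i) j))" for i
  proof -
    let ?c = "walk (node (m + i) j) (node (m + Suc i) j)"
    have c: "?c > 0" using walk_out[OF assms] by simp
    have "summable (\<lambda>n. ?c * survival ?y n (node (m + Suc i) j))"
    proof (rule summable_comparison_test')
      show "summable (\<lambda>n. survival ?y (Suc n) (node (m + i) j))"
        using that by (subst summable_Suc_iff)
      show "norm (?c * survival ?y n (node (m + Suc i) j)) \<le> survival ?y (Suc n) (node (m + i) j)" for n
        using survival_ge_step[OF in_spider in_spider node_ne_y, of "m + i" i n] c
          survival_nonneg[OF in_spider, of ?y n "m + Suc i"]
        by (simp del: survival.simps)
    qed
    then show ?thesis using c by simp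
  qed
  ultimately have "summable (\<lambda>n. survival ?y n (node (m + i) j))" for i
    by (induction i) simp_all
  then have summable: "summable (s i)" for i
    by (cases "i = 0") (simp_all add: s_def)
  define w where "w = (\<lambda>i. \<Sum>n. s i n)"
  have step: "s (Suc i) (Suc n) = (s i n + s (Suc (Suc i)) n) / 2" for i n
    using node_ne_y[of i] node_ne_y[of "Suc i"] node_ne_y[of "i - 1"]
    by (cases i) (simp_all add: s_def avg_leg[OF assms])
  \<comment> \<open>The summand 1 is the time-zero survival probability \<open>s (Suc i) 0\<close>,
    split off before the one-step recursion is summed.\<close>
  have w: "w (Suc i) = 1 + (w i + w (Suc (Suc i))) / 2" for i
  proof -
    have "(\<lambda>n. (s i n + s (Suc (Suc i)) n) / 2) sums ((w i + w (Suc (Suc i))) / 2)"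
      unfolding w_def by (intro sums_divide sums_add summable_sums summable)
    then have "(\<lambda>n. s (Suc i) (Suc n)) sums ((w i + w (Suc (Suc i))) / 2)"
      by (simp only: step)
    then have "s (Suc i) sums ((w i + w (Suc (Suc i))) / 2 + s (Suc i) 0)"
      by (subst (asm) sums_Suc_iff) simp
    then show ?thesis
      using sums_unique2[OF summable_sums[OF summable[of "Suc i"]]] by (simp add: w_def s_def)
  qed
  have w_nonneg: "0 \<le> w i" for i
    unfolding w_def
    by (rule suminf_nonneg[OF summable]) (simp add: s_def survival_nonneg in_spider)
  have incr: "w i \<le> w (Suc i)" for i
  proof (rule concave_nonneg_nondecreasing[of w])
    show "w (Suc (Suc i)) + w i \<le> 2 * w (Suc i)" for i using w[of i] by (simp add: field_simps)
  qed (rule w_nonneg)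
  have diff: "w (Suc i) - w i = w 1 - w 0 - 2 * real i" for i
  proof (induction i)
    case (Suc i)
    then show ?case using w[of i] by (simp add: field_simps)
  qed simp
  \<comment> \<open>The increments of \<open>w\<close> are nonnegative by \<open>incr\<close>, yet
    by \<open>diff\<close> they drop by 2 at every step.\<close>
  obtain i :: nat where "w 1 - w 0 < real i" using reals_Archimedean2 by blast
  then show False using diff[of i] incr[of i] by simp
qed

lemma walk_null_recurrent: "null_recurrent (spider N) walk"
  unfolding null_recurrent_def
proof (intro conjI ballI)
  fix x assume "x \<in> spider N"
  then obtain m j where x: "x = node m j" "1 \<le> j" "j \<le> N" by (auto simp: spider_def)
  show "(\<lambda>n. first_passage (spider N) walk x n x) sums 1"
    using \<open>x \<in> spider N\<close> by (intro first_passage_sums_1 liouville)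
  show "\<not> summable (\<lambda>n. real n * first_passage (spider N) walk x n x)"
    unfolding x(1) by (rule mean_return_time_infinite[OF x(2,3)])
qed (rule walk_markov)

section \<open>The invariant measure\<close>

text \<open>Every edge of leg \<open>k\<close>, including the one at the origin, carries the mass
  \<open>\<gamma>2 k / 2\<close> in each direction, so the measure is even reversible.\<close>

lemma walk_invariant_measure:
  "invariant_measure (spider N) walk (\<lambda>(n, k). if n = 0 then \<gamma>3 else \<gamma>2 k)"
  (is "invariant_measure _ _ ?\<mu>")
  unfolding invariant_measure_def
proof (intro conjI ballI)
  have \<mu>_node: "?\<mu> (node (Suc n) k) = \<gamma>2 k" "?\<mu> (node 0 k) = \<gamma>3" for n k
    by (simp_all add: node_def)
  show "0 \<le> ?\<mu> x" if "x \<in> spider N" for x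
    using that
  proof (cases rule: spider_cases)
    case 1
    then show ?thesis using leg_pos \<mu>_node(2) by simp
  next
    case (2 n k)
    then show ?thesis using exit_pos[of k] \<mu>_node(1) by simp
  qed
  show "\<exists>x\<in>spider N. ?\<mu> x \<noteq> 0"
  proof
    show "?\<mu> origin \<noteq> 0" using leg_pos \<mu>_node(2)[of 1] by linarith
  qed (rule origin_in_spider)
  fix y assume "y \<in> spider N"
  then show "((\<lambda>x. ?\<mu> x * walk x y) has_sum ?\<mu> y) (spider N)"
  proof (cases rule: spider_cases)
    case 1
    show ?thesis unfolding 1
    proof (rule has_sum_supported[OF _ origin_and_exits_subset])
      show "?\<mu> x * walk x origin = 0"
        if x: "x \<in> spider N" "x \<notin> insert origin (node 1 ` {1..N})" for x
      proof -
        obtain n k where "x = node (Suc (Suc n)) k" using not_origin_or_exit[OF x] .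
        then show ?thesis by (simp add: walk_leg node_eq_iff)
      qed
      have "?\<mu> (node 1 k) * walk (node 1 k) origin = \<gamma>2 k / 2" for k
        using \<mu>_node(1)[of 0 k] by (simp add: walk_leg node_0[of k])
      then have "(\<Sum>k=1..N. ?\<mu> (node 1 k) * walk (node 1 k) origin) = (\<Sum>k=1..N. \<gamma>2 k) / 2"
        by (simp only: sum_divide_distrib)
      \<comment> \<open>The missing \<open>\<gamma>1 / 2\<close> is the mass that the loop returns
        to the origin.\<close>
      also have "\<dots> = \<gamma>3 - \<gamma>1 / 2" using critical by simp
      finally show "(\<Sum>x\<in>insert origin (node 1 ` {1..N}). ?\<mu> x * walk x origin) = ?\<mu> origin"
        unfolding sum_origin_and_exits walk_origin_origin \<mu>_node(2)
        using leg_pos by (simp add: field_simps)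
    qed simp
  next
    case (2 n k)
    show ?thesis
    proof (rule has_sum_supported)
      show "{node n k, node (Suc (Suc n)) k} \<subseteq> spider N"
        using node_in_spider[OF 2(2,3)] by blast
      show "?\<mu> x * walk x y = 0"
        if x: "x \<in> spider N" "x \<notin> {node n k, node (Suc (Suc n)) k}" for x
        using x(1)
      proof (cases rule: spider_cases)
        case 1
        \<comment> \<open>The origin sends mass to \<open>node (Suc n) k\<close> only for
          \<open>n = 0\<close>, and then it belongs to the excluded set.\<close>
        have "n \<noteq> 0"
        proof
          assume "n = 0"
          then show False using 1 x(2) node_0[of k] by simp
        qed
        then show ?thesis unfolding 1 \<open>y = node (Suc n) k\<close> by (simp add: walk_origin_leg)
      next
        case x_eq: (2 m j)
        have "node (Suc n) k \<noteq> node m j"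
          using x(2) x_eq(1) by (cases m) (auto simp: node_eq_iff)
        moreover have "node (Suc n) k \<noteq> node (Suc (Suc m)) j"
          using x(2) x_eq(1) by (auto simp: node_eq_iff)
        ultimately show ?thesis
          unfolding x_eq(1) \<open>y = node (Suc n) k\<close> by (simp add: walk_leg)
      qed
      have "?\<mu> (node n k) * walk (node n k) (node (Suc n) k) = \<gamma>2 k / 2"
      proof (cases n)
        case 0
        then show ?thesis using \<mu>_node(2)[of k] leg_pos by (simp add: walk_origin_leg)
      next
        case (Suc m)
        then show ?thesis using \<mu>_node(1)[of m k] by (simp add: walk_leg)
      qed
      moreover have "?\<mu> (node (Suc (Suc n)) k) * walk (node (Suc (Suc n)) k) (node (Suc n) k) = \<gamma>2 k / 2"
        using \<mu>_node(1)[of "Suc n" k] by (simp add: walk_leg)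
      moreover have "(\<Sum>x\<in>{node n k, node (Suc (Suc n)) k}. ?\<mu> x * walk x y)
          = ?\<mu> (node n k) * walk (node n k) (node (Suc n) k)
          + ?\<mu> (node (Suc (Suc n)) k) * walk (node (Suc (Suc n)) k) (node (Suc n) k)"
        using node_ne[of n k] 2(1) by simp
      moreover have "?\<mu> y = \<gamma>2 k"
        by (simp only: 2(1) \<mu>_node(1))
      ultimately show "(\<Sum>x\<in>{node n k, node (Suc (Suc n)) k}. ?\<mu> x * walk x y) = ?\<mu> y"
        by linarith
    qed simp
  qed
qed

section \<open>Spectral radius, eigenfunctions and the MERW\<close>

lemma adj_walk: "spider_adj \<gamma>1 \<gamma>2 \<gamma>3 = (\<lambda>x y. 2 * \<gamma>3 * walk x y)"
  using leg_pos by (simp add: walk_def fun_eq_iff)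

lemma spectral_radius: "comb_spectral_radius (spider N) (spider_adj \<gamma>1 \<gamma>2 \<gamma>3) = 2 * \<gamma>3"
  unfolding adj_walk using origin_in_spider leg_pos
  by (intro comb_spectral_radius_scaled liouville irreducible) auto

text \<open>Division by \<open>2 * \<gamma>3\<close> turns positive eigenfunctions into positive
  harmonic functions of the walk, to which the Liouville property applies.\<close>

lemma eigenfunction_iff:
  "positive_eigenfunction (spider N) (spider_adj \<gamma>1 \<gamma>2 \<gamma>3) (2 * \<gamma>3) \<psi> \<longleftrightarrow>
     (\<forall>x\<in>spider N. \<psi> x > 0 \<and> avg \<psi> x = \<psi> x)"
proof -
  have "((\<lambda>y. spider_adj \<gamma>1 \<gamma>2 \<gamma>3 x y * \<psi> y) has_sum 2 * \<gamma>3 * \<psi> x) (spider N)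
      \<longleftrightarrow> avg \<psi> x = \<psi> x" if "x \<in> spider N" for x
  proof -
    have sum: "((\<lambda>y. spider_adj \<gamma>1 \<gamma>2 \<gamma>3 x y * \<psi> y) has_sum 2 * \<gamma>3 * avg \<psi> x) (spider N)"
      using has_sum_cmult_right[OF has_sum_avg[OF that], of "2 * \<gamma>3" \<psi>]
      by (simp only: adj_walk mult.assoc)
    show ?thesis
    proof
      assume "((\<lambda>y. spider_adj \<gamma>1 \<gamma>2 \<gamma>3 x y * \<psi> y) has_sum 2 * \<gamma>3 * \<psi> x) (spider N)"
      then have "2 * \<gamma>3 * avg \<psi> x = 2 * \<gamma>3 * \<psi> x" by (rule has_sum_unique[OF sum])
      then show "avg \<psi> x = \<psi> x" using leg_pos by simp
    qed (use sum in simp)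
  qed
  then show ?thesis unfolding positive_eigenfunction_def by blast
qed

lemma eigenfunction_one:
  "positive_eigenfunction (spider N) (spider_adj \<gamma>1 \<gamma>2 \<gamma>3) (2 * \<gamma>3) (\<lambda>x. 1)"
  by (simp add: eigenfunction_iff avg_const)

lemma eigenfunction_const:
  assumes "positive_eigenfunction (spider N) (spider_adj \<gamma>1 \<gamma>2 \<gamma>3) (2 * \<gamma>3) \<psi>"
  shows "\<exists>c>0. \<forall>x\<in>spider N. \<psi> x = c"
proof -
  have "\<psi> x = \<psi> origin" if "x \<in> spider N" for x
    using assms that unfolding eigenfunction_iff
    by (intro superharmonic_const) (auto simp: less_imp_le)
  then show ?thesis using assms origin_in_spider unfolding eigenfunction_iff by blast
qed

text \<open>Every admissible \<psi> is constant and cancels from the quotient, leaving the adjacency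
  matrix divided by \<open>2 * \<gamma>3\<close>. Kernels are compared on the spider only, as their
  other values carry no meaning.\<close>

lemma merw_kernel_iff:
  "merw_kernel (spider N) (spider_adj \<gamma>1 \<gamma>2 \<gamma>3) Q \<longleftrightarrow>
     markov_kernel (spider N) Q \<and> (\<forall>x\<in>spider N. \<forall>y\<in>spider N. Q x y = walk x y)"
  (is "?L \<longleftrightarrow> ?R")
proof
  assume ?L
  then obtain \<psi> where Q: "markov_kernel (spider N) Q"
    and \<psi>: "positive_eigenfunction (spider N) (spider_adj \<gamma>1 \<gamma>2 \<gamma>3) (2 * \<gamma>3) \<psi>"
    and eq: "\<forall>x\<in>spider N. \<forall>y\<in>spider N.
      Q x y = spider_adj \<gamma>1 \<gamma>2 \<gamma>3 x y * (\<psi> y / (2 * \<gamma>3 * \<psi> x))"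
    unfolding merw_kernel_def spectral_radius by blast
  obtain c where "c > 0" "\<forall>x\<in>spider N. \<psi> x = c" using eigenfunction_const[OF \<psi>] by blast
  then show ?R using Q eq by (auto simp: walk_def)
next
  assume ?R
  then show ?L
    unfolding merw_kernel_def spectral_radius
    using eigenfunction_one by (auto simp: walk_def intro!: exI[of _ "\<lambda>_. 1"])
qed

end

theorem proposition3p2:
  fixes N :: nat and \<gamma>1 \<gamma>3 :: real and \<gamma>2 :: "nat \<Rightarrow> real"
  assumes "N \<ge> 1"
    and "\<gamma>1 \<ge> 0"
    and "\<And>k. 1 \<le> k \<Longrightarrow> k \<le> N \<Longrightarrow> \<gamma>2 k > 0"
    and "\<gamma>3 > 0"
    and "2 * \<gamma>3 - \<gamma>1 - (\<Sum>k=1..N. \<gamma>2 k) = 0"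
  shows "(let G = spider N; A = spider_adj \<gamma>1 \<gamma>2 \<gamma>3; \<rho> = comb_spectral_radius G A in
    positive_eigenfunction G A \<rho> (\<lambda>x. 1) \<and>
    (\<forall>\<psi>. positive_eigenfunction G A \<rho> \<psi> \<longrightarrow> (\<exists>c>0. \<forall>x\<in>G. \<psi> x = c * 1)) \<and>
    (\<exists>P. merw_kernel G A P \<and>
      (\<forall>Q. merw_kernel G A Q \<longrightarrow> (\<forall>x\<in>G. \<forall>y\<in>G. Q x y = P x y)) \<and>
      (\<forall>k n. 1 \<le> k \<and> k \<le> N \<and> 1 \<le> n \<longrightarrow>
        P (node n k) (node (n + 1) k) = 1 / 2 \<and>
        P (node n k) (node (n - 1) k) = 1 / 2 \<and>
        P origin (node 1 k) = \<gamma>2 k / (2 * \<gamma>3) \<and>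
        P origin origin = \<gamma>1 / (2 * \<gamma>3)) \<and>
      null_recurrent G P \<and>
      invariant_measure G P (\<lambda>(n, k). if n = 0 then \<gamma>3 else \<gamma>2 k)))"
proof -
  interpret critical_spider N \<gamma>1 \<gamma>3 \<gamma>2
    using assms by unfold_locales
  have probabilities: "\<forall>k n. 1 \<le> k \<and> k \<le> N \<and> 1 \<le> n \<longrightarrow>
      walk (node n k) (node (n + 1) k) = 1 / 2 \<and>
      walk (node n k) (node (n - 1) k) = 1 / 2 \<and>
      walk origin (node 1 k) = \<gamma>2 k / (2 * \<gamma>3) \<and>
      walk origin origin = \<gamma>1 / (2 * \<gamma>3)"
  proof (intro allI impI)
    fix k n :: nat assume "1 \<le> k \<and> k \<le> N \<and> 1 \<le> n"
    then obtain m where "n = Suc m" by (cases n) auto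
    then show "walk (node n k) (node (n + 1) k) = 1 / 2 \<and>
        walk (node n k) (node (n - 1) k) = 1 / 2 \<and>
        walk origin (node 1 k) = \<gamma>2 k / (2 * \<gamma>3) \<and>
        walk origin origin = \<gamma>1 / (2 * \<gamma>3)"
      by (simp add: walk_leg walk_origin_origin walk_origin_leg)
  qed
  show ?thesis
    unfolding Let_def spectral_radius mult_1_right
    by (intro conjI exI[of _ walk] eigenfunction_one walk_null_recurrent walk_invariant_measure
        probabilities)
      (use eigenfunction_const in \<open>auto simp: merw_kernel_iff walk_markov\<close>)
qed

end
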